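(* Consider the autonomous ($\epsilon=0$) mechanical system $\mathbf M\ddot y+\mathbf C\dot y+\mathbf K y+f(y,\dot y)=0$, its first-order form $\mathbf B\dot z=\mathbf A z+F(z)$, $z=(y,\dot y)$, and let $W(p)=\begin{bmatrix} w(p)\\ \dot w(p)\end{bmatrix}$ and $R(p)$ be a parametrization of an invariant manifold and its reduced vector field, i.e. satisfy the autonomous invariance equation $$\mathbf B\,(DW(p))\,R(p)=\mathbf A\,W(p)+F(W(p)),$$ with expansions $w(p)=\sum_{m}w_m p^m$, $\dot w(p)=\sum_m\dot w_m p^m$, $R(p)=\sum_m R_mp^m$, $m\in\mathbb N^M$. Then for every multi-index $m\in\mathbb N^M$ the coefficient of the velocity parametrization is obtained directly from the displacement parametrization as $$\dot w_m=\big[Dw(p)\,R(p)\big]_m,$$ where $[\,\cdot\,]_m$ denotes the coefficient of $p^m$.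
   Context: $\mathbf M,\mathbf C,\mathbf K\in\mathbb R^{n\times n}$ are the mass, damping and stiffness matrices, with $\mathbf M$ nonsingular, and $$\mathbf A=\begin{bmatrix}-\mathbf K&0\\0&\mathbf M\end{bmatrix},\quad \mathbf B=\begin{bmatrix}\mathbf C&\mathbf M\\ \mathbf M&0\end{bmatrix},\quad F(z)=\begin{bmatrix}-f(y,\dot y)\\0\end{bmatrix}.$$ $p\in\mathbb C^M$ are the parametrization coordinates, whose dynamics is $\dot p=R(p)$; $w$ is the displacement block of $W$ (with $w_m\in\mathbb C^n$) and the symbol $\dot w$ denotes its velocity block (with $\dot w_m\in\mathbb C^n$); $R_m\in\mathbb C^M$. $D$ is the derivative with respect to $p$. For $m\in\mathbb N^M$, $p^m=p_1^{m_1}\cdots p_M^{m_M}$. Expansions are (formal) power series in $p$ with $W(0)=0$ and $R(0)=0$. *)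

theory Defs
  imports "HOL-Analysis.Analysis"
begin

section \<open>Formal power series in finitely many commuting variables\<close>

text \<open>
  A series in the variables \<open>(x\<^sub>i)\<close>, \<open>i :: 'v\<close>, is the family of its coefficients, indexed by the
  multi-indices \<open>m :: nat^'v\<close>. Multi-indices are added componentwise, and
  \<open>axis i 1\<close> is the \<open>i\<close>-th unit multi-index.
\<close>

typedef ('a, 'v::finite) mps = "UNIV :: (nat^'v \<Rightarrow> 'a) set"
  morphisms mps_nth Abs_mps ..

setup_lifting type_definition_mps

lemma mps_eqI: "(\<And>m. mps_nth f m = mps_nth g m) \<Longrightarrow> f = g"
  by transfer auto

lemma mps_nth_Abs [simp]: "mps_nth (Abs_mps f) m = f m"
  by (simp add: Abs_mps_inverse)

definition splits :: "nat^'v::finite \<Rightarrow> ((nat^'v) \<times> (nat^'v)) set" where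
  "splits m = {(a, b). a + b = m}"

lemma finite_multiindex_le: "finite {a :: nat^'v::finite. \<forall>i. a $ i \<le> k i}"
proof -
  have "{a :: nat^'v. \<forall>i. a $ i \<le> k i} \<subseteq> vec_lambda ` (PiE UNIV (\<lambda>i. {..k i}))"
  proof
    fix a :: "nat^'v" assume "a \<in> {a. \<forall>i. a $ i \<le> k i}"
    then have "vec_nth a \<in> PiE UNIV (\<lambda>i. {..k i})" by auto
    then show "a \<in> vec_lambda ` (PiE UNIV (\<lambda>i. {..k i}))"
      by (metis image_eqI vec_nth_inverse)
  qed
  then show ?thesis
    by (rule finite_subset) (intro finite_imageI finite_PiE; simp)
qed

lemma finite_splits [simp]: "finite (splits m)"
proof -
  have "splits m \<subseteq> {a. \<forall>i. a $ i \<le> m $ i} \<times> {a. \<forall>i. a $ i \<le> m $ i}"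
    by (auto simp: splits_def)
  then show ?thesis
    by (rule finite_subset) (intro finite_cartesian_product finite_multiindex_le)
qed

lemma multiindex_add_eq_0_iff: "a + b = (0 :: nat^'v::finite) \<longleftrightarrow> a = 0 \<and> b = 0"
  by (auto simp: vec_eq_iff)

lemma splits_0: "splits 0 = {(0, 0)}"
  by (auto simp: splits_def multiindex_add_eq_0_iff)

instantiation mps :: (zero, finite) zero
begin
definition "0 = Abs_mps (\<lambda>_. 0)"
instance ..
end

instantiation mps :: (zero_neq_one, finite) one
begin
definition "1 = Abs_mps (\<lambda>m. if m = 0 then 1 else 0)"
instance ..
end

instantiation mps :: (plus, finite) plus
begin
definition "f + g = Abs_mps (\<lambda>m. mps_nth f m + mps_nth g m)"
instance ..
end

instantiation mps :: (minus, finite) minus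
begin
definition "f - g = Abs_mps (\<lambda>m. mps_nth f m - mps_nth g m)"
instance ..
end

instantiation mps :: (uminus, finite) uminus
begin
definition "- f = Abs_mps (\<lambda>m. - mps_nth f m)"
instance ..
end

instantiation mps :: (semiring_0, finite) times
begin
definition "f * g = Abs_mps (\<lambda>m. \<Sum>(a, b)\<in>splits m. mps_nth f a * mps_nth g b)"
instance ..
end

lemma mps_nth_0 [simp]: "mps_nth 0 m = 0"
  by (simp add: zero_mps_def)

lemma mps_nth_1: "mps_nth 1 m = (if m = 0 then 1 else 0)"
  by (simp add: one_mps_def)

lemma mps_nth_add [simp]: "mps_nth (f + g) m = mps_nth f m + mps_nth g m"
  by (simp add: plus_mps_def)

lemma mps_nth_diff [simp]: "mps_nth (f - g) m = mps_nth f m - mps_nth g m"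
  by (simp add: minus_mps_def)

lemma mps_nth_uminus [simp]: "mps_nth (- f) m = - mps_nth f m"
  by (simp add: uminus_mps_def)

lemma mps_nth_mult:
  "mps_nth (f * g) m = (\<Sum>(a, b)\<in>splits m. mps_nth f a * mps_nth g b)"
  by (simp add: times_mps_def)

lemma mps_mult_commute: "f * g = g * (f :: ('a::comm_semiring_0, 'v::finite) mps)"
proof (rule mps_eqI)
  fix m
  show "mps_nth (f * g) m = mps_nth (g * f) m"
    unfolding mps_nth_mult
    by (rule sum.reindex_bij_witness[where i = prod.swap and j = prod.swap])
       (auto simp: splits_def add.commute mult.commute)
qed

lemma mps_mult_assoc: "f * g * h = f * (g * (h :: ('a::comm_semiring_0, 'v::finite) mps))"
proof (rule mps_eqI)
  fix m
  have "mps_nth (f * g * h) m =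
      (\<Sum>p\<in>splits m. \<Sum>q\<in>splits (fst p).
         mps_nth f (fst q) * mps_nth g (snd q) * mps_nth h (snd p))"
    by (simp add: mps_nth_mult sum_distrib_right case_prod_unfold)
  also have "\<dots> = (\<Sum>(p, q)\<in>(SIGMA p:splits m. splits (fst p)).
         mps_nth f (fst q) * mps_nth g (snd q) * mps_nth h (snd p))"
    by (simp add: sum.Sigma)
  also have "\<dots> = (\<Sum>(p, q)\<in>(SIGMA p:splits m. splits (snd p)).
         mps_nth f (fst p) * (mps_nth g (fst q) * mps_nth h (snd q)))"
    by (rule sum.reindex_bij_witness[where
          i = "\<lambda>(p, q). ((fst p + fst q, snd q), (fst p, fst q))" and
          j = "\<lambda>(p, q). ((fst q, snd q + snd p), (snd q, snd p))"])
       (auto simp: splits_def add.assoc mult.assoc)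
  also have "\<dots> = (\<Sum>p\<in>splits m. \<Sum>q\<in>splits (snd p).
         mps_nth f (fst p) * (mps_nth g (fst q) * mps_nth h (snd q)))"
    by (simp add: sum.Sigma)
  also have "\<dots> = mps_nth (f * (g * h)) m"
    by (simp add: mps_nth_mult sum_distrib_left case_prod_unfold)
  finally show "mps_nth (f * g * h) m = mps_nth (f * (g * h)) m" .
qed

lemma mps_mult_1: "1 * f = (f :: ('a::comm_semiring_1, 'v::finite) mps)"
proof (rule mps_eqI)
  fix m
  have "mps_nth (1 * f) m = (\<Sum>p\<in>splits m. if p = (0, m) then mps_nth f m else 0)"
    unfolding mps_nth_mult by (rule sum.cong) (auto simp: splits_def mps_nth_1 split: if_splits)
  also have "\<dots> = mps_nth f m"
    by (subst sum.delta, rule finite_splits) (simp add: splits_def)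
  finally show "mps_nth (1 * f) m = mps_nth f m" .
qed

instance mps :: (comm_ring_1, finite) comm_ring_1
proof
  fix f g h :: "('a, 'b) mps"
  show "f + g + h = f + (g + h)" "f + g = g + f" "0 + f = f" "- f + f = 0" "f - g = f + - g"
    by (rule mps_eqI; simp add: algebra_simps)+
  show "f * g * h = f * (g * h)" by (rule mps_mult_assoc)
  show "f * g = g * f" by (rule mps_mult_commute)
  show "1 * f = f" by (rule mps_mult_1)
  show "(f + g) * h = f * h + g * h"
    by (rule mps_eqI) (simp add: mps_nth_mult case_prod_unfold distrib_right sum.distrib)
  have "mps_nth (0 :: ('a, 'b) mps) 0 \<noteq> mps_nth 1 0" by (simp add: mps_nth_1)
  then show "(0 :: ('a, 'b) mps) \<noteq> 1" by metis
qed

definition mps_const :: "'a::zero \<Rightarrow> ('a, 'v::finite) mps" where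
  "mps_const c = Abs_mps (\<lambda>m. if m = 0 then c else 0)"

definition mps_map :: "('a \<Rightarrow> 'b) \<Rightarrow> ('a, 'v::finite) mps \<Rightarrow> ('b, 'v) mps" where
  "mps_map h f = Abs_mps (\<lambda>m. h (mps_nth f m))"

definition mps_deriv :: "'v \<Rightarrow> ('a::semiring_1, 'v::finite) mps \<Rightarrow> ('a, 'v) mps" where
  "mps_deriv i f = Abs_mps (\<lambda>m. of_nat (Suc (m $ i)) * mps_nth f (m + axis i 1))"

definition mps_compose ::
    "('a::comm_ring_1, 'v::finite) mps \<Rightarrow> ('a, 'u::finite) mps ^ 'v \<Rightarrow> ('a, 'u) mps" where
  "mps_compose g W = Abs_mps (\<lambda>m.
     \<Sum>\<alpha> | (\<Sum>j\<in>UNIV. \<alpha> $ j) \<le> (\<Sum>i\<in>UNIV. m $ i).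
       mps_nth g \<alpha> * mps_nth (\<Prod>j\<in>UNIV. (W $ j) ^ (\<alpha> $ j)) m)"

text \<open>
  \<^const>\<open>mps_compose\<close> is substitution \<open>\<Sum>\<^sub>\<alpha> g\<^sub>\<alpha> W\<^sup>\<alpha>\<close> for \<open>W\<close> without constant term: the terms cut
  off in its definition then vanish (see \<open>mps_nth_monomial_eq_0\<close> below).
\<close>

lemma finite_multiindex_degree_le: "finite {\<alpha> :: nat^'v::finite. (\<Sum>j\<in>UNIV. \<alpha> $ j) \<le> k}"
proof (rule finite_subset)
  show "{\<alpha> :: nat^'v. (\<Sum>j\<in>UNIV. \<alpha> $ j) \<le> k} \<subseteq> {\<alpha>. \<forall>j. \<alpha> $ j \<le> k}"
  proof clarify
    fix \<alpha> :: "nat^'v" and j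
    assume "(\<Sum>j\<in>UNIV. \<alpha> $ j) \<le> k"
    moreover have "\<alpha> $ j \<le> (\<Sum>j\<in>UNIV. \<alpha> $ j)" by (rule member_le_sum) auto
    ultimately show "\<alpha> $ j \<le> k" by simp
  qed
qed (rule finite_multiindex_le)

definition mps_ord_ge :: "nat \<Rightarrow> ('a::zero, 'v::finite) mps \<Rightarrow> bool" where
  "mps_ord_ge k f \<longleftrightarrow> (\<forall>m. (\<Sum>i\<in>UNIV. m $ i) < k \<longrightarrow> mps_nth f m = 0)"

lemma mps_ord_ge_mult:
  fixes f g :: "('a::comm_ring_1, 'v::finite) mps"
  assumes "mps_ord_ge k f" "mps_ord_ge l g"
  shows "mps_ord_ge (k + l) (f * g)"
  unfolding mps_ord_ge_def
proof (intro allI impI)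
  fix m :: "nat^'v" assume m: "(\<Sum>i\<in>UNIV. m $ i) < k + l"
  have "mps_nth f a * mps_nth g b = 0" if "a + b = m" for a b
  proof -
    have "(\<Sum>i\<in>UNIV. a $ i) + (\<Sum>i\<in>UNIV. b $ i) < k + l"
      using m that by (auto simp: sum.distrib)
    then have "(\<Sum>i\<in>UNIV. a $ i) < k \<or> (\<Sum>i\<in>UNIV. b $ i) < l" by linarith
    then show ?thesis using assms by (auto simp: mps_ord_ge_def)
  qed
  then show "mps_nth (f * g) m = 0"
    by (auto simp: mps_nth_mult splits_def intro!: sum.neutral)
qed

lemma mps_ord_ge_power:
  fixes f :: "('a::comm_ring_1, 'v::finite) mps"
  assumes "mps_ord_ge 1 f"
  shows "mps_ord_ge k (f ^ k)"
proof (induction k)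
  case 0
  then show ?case by (simp add: mps_ord_ge_def)
next
  case (Suc k)
  then show ?case using mps_ord_ge_mult[OF assms, of k "f ^ k"] by simp
qed

lemma mps_ord_ge_prod:
  fixes f :: "'j \<Rightarrow> ('a::comm_ring_1, 'v::finite) mps"
  assumes "finite J" "\<And>j. j \<in> J \<Longrightarrow> mps_ord_ge (k j) (f j)"
  shows "mps_ord_ge (\<Sum>j\<in>J. k j) (\<Prod>j\<in>J. f j)"
  using assms
proof (induction J rule: finite_induct)
  case empty
  then show ?case by (simp add: mps_ord_ge_def)
next
  case (insert j J)
  then show ?case by (simp add: mps_ord_ge_mult)
qed

lemma mps_nth_monomial_eq_0:
  fixes W :: "('a::comm_ring_1, 'u::finite) mps ^ 'v::finite"
  assumes "\<And>j. mps_nth (W $ j) 0 = 0"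
    and "(\<Sum>i\<in>UNIV. m $ i) < (\<Sum>j\<in>UNIV. \<alpha> $ j)"
  shows "mps_nth (\<Prod>j\<in>UNIV. (W $ j) ^ (\<alpha> $ j)) m = 0"
proof -
  have "mps_ord_ge 1 (W $ j)" for j
    unfolding mps_ord_ge_def
  proof (intro allI impI)
    fix m :: "nat^'u" assume "(\<Sum>i\<in>UNIV. m $ i) < 1"
    then have "m = 0" by (simp add: vec_eq_iff)
    then show "mps_nth (W $ j) m = 0" using assms(1) by simp
  qed
  then have "mps_ord_ge (\<Sum>j\<in>UNIV. \<alpha> $ j) (\<Prod>j\<in>UNIV. (W $ j) ^ (\<alpha> $ j))"
    by (intro mps_ord_ge_prod mps_ord_ge_power) auto
  then show ?thesis using assms(2) by (simp add: mps_ord_ge_def)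
qed


section \<open>Vectors of formal power series\<close>

definition vmps_nth :: "('a, 'v::finite) mps ^ 'k \<Rightarrow> nat^'v \<Rightarrow> 'a ^ 'k" where
  "vmps_nth W m = (\<chi> k. mps_nth (W $ k) m)"

definition vmps_jacobian :: "('a::semiring_1, 'v::finite) mps ^ 'k \<Rightarrow> ('a, 'v) mps ^ 'v ^ 'k" where
  "vmps_jacobian W = (\<chi> k i. mps_deriv i (W $ k))"

definition vmps_compose ::
    "('a::comm_ring_1, 'v::finite) mps ^ 'k \<Rightarrow> ('a, 'u::finite) mps ^ 'v \<Rightarrow> ('a, 'u) mps ^ 'k" where
  "vmps_compose G W = (\<chi> k. mps_compose (G $ k) W)"

definition complex_vmps :: "(real, 'v::finite) mps ^ 'k \<Rightarrow> (complex, 'v) mps ^ 'k" where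
  "complex_vmps G = (\<chi> k. mps_map complex_of_real (G $ k))"

definition const_matrix :: "real ^ 'l ^ 'k \<Rightarrow> (complex, 'v::finite) mps ^ 'l ^ 'k" where
  "const_matrix P = map_matrix (\<lambda>x. mps_const (complex_of_real x)) P"


section \<open>First-order form of a mechanical system\<close>

text \<open>
  Phase space is indexed by \<open>'n + 'n\<close>: the summand \<open>Inl\<close> carries the displacements, \<open>Inr\<close> the
  velocities. The nonlinearity \<open>f\<close> is a series in the \<open>2n\<close> variables \<open>z = (y, dy/dt)\<close>.
\<close>

definition block_vec :: "'a ^ 'n \<Rightarrow> 'a ^ 'n \<Rightarrow> 'a ^ ('n + 'n)" where
  "block_vec u v = (\<chi> k. case k of Inl i \<Rightarrow> u $ i | Inr i \<Rightarrow> v $ i)"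

definition block_mat ::
    "'a ^ 'n ^ 'n \<Rightarrow> 'a ^ 'n ^ 'n \<Rightarrow> 'a ^ 'n ^ 'n \<Rightarrow> 'a ^ 'n ^ 'n \<Rightarrow> 'a ^ ('n + 'n) ^ ('n + 'n)" where
  "block_mat P Q S T =
     (\<chi> k. case k of Inl i \<Rightarrow> block_vec (P $ i) (Q $ i) | Inr i \<Rightarrow> block_vec (S $ i) (T $ i))"

definition sys_A :: "real ^ 'n ^ 'n \<Rightarrow> real ^ 'n ^ 'n \<Rightarrow> real ^ ('n + 'n) ^ ('n + 'n)" where
  "sys_A M K = block_mat (- K) 0 0 M"

definition sys_B :: "real ^ 'n ^ 'n \<Rightarrow> real ^ 'n ^ 'n \<Rightarrow> real ^ ('n + 'n) ^ ('n + 'n)" where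
  "sys_B M C = block_mat C M M 0"

definition sys_F :: "(real, 'n + 'n) mps ^ 'n \<Rightarrow> (real, 'n::finite + 'n) mps ^ ('n + 'n)" where
  "sys_F f = block_vec (- f) 0"

definition invariance_equation ::
    "real ^ 'n ^ 'n \<Rightarrow> real ^ 'n ^ 'n \<Rightarrow> real ^ 'n ^ 'n \<Rightarrow> (real, 'n::finite + 'n) mps ^ 'n
      \<Rightarrow> (complex, 'M::finite) mps ^ ('n + 'n) \<Rightarrow> (complex, 'M) mps ^ 'M \<Rightarrow> bool" where
  "invariance_equation M C K f W R \<longleftrightarrow>
     const_matrix (sys_B M C) *v (vmps_jacobian W *v R) =
       const_matrix (sys_A M K) *v W + vmps_compose (complex_vmps (sys_F f)) W"

end

theory Submission
  imports Defs
begin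

text \<open>
  Besides the balance of forces, the first-order form \<open>B z' = A z + F(z)\<close> contains in its lower
  block row the trivial identity \<open>M y' = M v\<close> for \<open>z = (y, v)\<close>, which involves neither the
  nonlinearity, nor damping and stiffness. Read along the parametrization \<open>(w, w_dot)\<close>, where
  \<open>z'\<close> is \<open>DW R\<close>, that row says \<open>M (Dw R) = M w_dot\<close> as formal power series. Multiplication by a
  constant matrix acts on each coefficient separately (\<open>vmps_nth_const_matrix_mult\<close>), and an
  invertible real matrix acts injectively on complex vectors
  (\<open>complex_of_real_matrix_mult_cancel\<close>). So \<open>M\<close> can be cancelled coefficient by coefficient.
\<close>

section \<open>Constant matrices acting on vectors of power series\<close>

lemma mps_nth_const_mult: "mps_nth (mps_const c * g) m = c * mps_nth g m"
  for g :: "('a::comm_semiring_1, 'v::finite) mps"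
proof -
  have "mps_nth (mps_const c * g) m =
      (\<Sum>p\<in>splits m. if p = (0, m) then c * mps_nth g m else 0)"
    unfolding mps_nth_mult
    by (rule sum.cong) (auto simp: splits_def mps_const_def split: if_splits)
  also have "\<dots> = c * mps_nth g m"
    by (subst sum.delta, rule finite_splits) (simp add: splits_def)
  finally show ?thesis .
qed

lemma mps_nth_sum: "mps_nth (\<Sum>j\<in>J. g j) m = (\<Sum>j\<in>J. mps_nth (g j) m)"
  for g :: "'j \<Rightarrow> ('a::comm_ring_1, 'v::finite) mps"
  by (induction J rule: infinite_finite_induct) auto

lemma vmps_nth_const_matrix_mult:
  "vmps_nth (const_matrix P *v V) m = map_matrix complex_of_real P *v vmps_nth V m"
  by (simp add: vec_eq_iff vmps_nth_def const_matrix_def map_matrix_def matrix_vector_mult_def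
      mps_nth_sum mps_nth_const_mult)

text \<open>The real inverse, read as a complex matrix, is still a left inverse.\<close>

lemma complex_of_real_matrix_mult_cancel:
  fixes M :: "real ^ 'n ^ 'n" and x y :: "complex ^ 'n"
  assumes "invertible M"
    and "map_matrix complex_of_real M *v x = map_matrix complex_of_real M *v y"
  shows "x = y"
proof -
  obtain N where N: "N ** M = mat 1"
    using assms(1) by (auto simp: invertible_def)
  have "map_matrix complex_of_real N ** map_matrix complex_of_real M =
      map_matrix complex_of_real (N ** M)"
    by (simp add: vec_eq_iff map_matrix_def matrix_matrix_mult_def)
  also have "\<dots> = mat 1"
    unfolding N by (simp add: vec_eq_iff map_matrix_def mat_def)
  finally have left_inverse:
    "map_matrix complex_of_real N ** map_matrix complex_of_real M = mat 1" .
  have "x = map_matrix complex_of_real N *v (map_matrix complex_of_real M *v x)"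
    by (simp add: matrix_vector_mul_assoc left_inverse)
  also have "\<dots> = map_matrix complex_of_real N *v (map_matrix complex_of_real M *v y)"
    by (simp add: assms(2))
  also have "\<dots> = y"
    by (simp add: matrix_vector_mul_assoc left_inverse)
  finally show ?thesis .
qed

section \<open>Block structure of the invariance equation\<close>

lemma block_vec_eq_iff: "block_vec u v = block_vec u' v' \<longleftrightarrow> u = u' \<and> v = v'"
  by (auto simp: block_vec_def vec_eq_iff split: sum.splits)

lemma block_vec_add: "block_vec u v + block_vec u' v' = block_vec (u + u') (v + v')"
  by (auto simp: block_vec_def vec_eq_iff split: sum.splits)

lemma const_matrix_block_mat_mult:
  "const_matrix (block_mat P Q S T) *v block_vec u v =
    block_vec (const_matrix P *v u + const_matrix Q *v v)
      (const_matrix S *v u + const_matrix T *v v)"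
proof -
  have sum_Plus: "(\<Sum>k\<in>UNIV. g k) = (\<Sum>i\<in>UNIV. g (Inl i)) + (\<Sum>i\<in>UNIV. g (Inr i))"
    for g :: "'b::finite + 'b \<Rightarrow> (complex, 'c::finite) mps"
    using sum.Plus[of "UNIV :: 'b set" "UNIV :: 'b set" g]
    by (simp add: comp_def)
  show ?thesis
    by (auto simp: vec_eq_iff block_vec_def block_mat_def const_matrix_def map_matrix_def
        matrix_vector_mult_def sum_Plus split: sum.splits)
qed

lemma mps_const_0: "mps_const 0 = 0"
  by (rule mps_eqI) (simp add: mps_const_def)

lemma const_matrix_0_mult: "const_matrix 0 *v V = 0"
  by (simp add: vec_eq_iff const_matrix_def map_matrix_def matrix_vector_mult_def mps_const_0)

lemma vmps_jacobian_block_vec_mult: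
  "vmps_jacobian (block_vec u v) *v R = block_vec (vmps_jacobian u *v R) (vmps_jacobian v *v R)"
  by (auto simp: vec_eq_iff block_vec_def vmps_jacobian_def matrix_vector_mult_def
      split: sum.splits)

lemma mps_map_of_real_0: "mps_map complex_of_real 0 = 0"
  by (rule mps_eqI) (simp add: mps_map_def)

lemma mps_compose_0: "mps_compose 0 W = 0"
  by (rule mps_eqI) (simp add: mps_compose_def)

text \<open>The nonlinear force enters only the balance of forces, the upper block row.\<close>

lemma sys_F_compose_block_vec:
  "vmps_compose (complex_vmps (sys_F f)) W = block_vec (vmps_compose (complex_vmps (- f)) W) 0"
  by (auto simp: vec_eq_iff vmps_compose_def complex_vmps_def sys_F_def block_vec_def
      mps_map_of_real_0 mps_compose_0 split: sum.splits)

lemma invariance_equation_velocity_row: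
  assumes "invariance_equation M C K f (block_vec w w_dot) R"
  shows "const_matrix M *v (vmps_jacobian w *v R) = const_matrix M *v w_dot"
  using assms
  by (simp add: invariance_equation_def sys_A_def sys_B_def vmps_jacobian_block_vec_mult
      const_matrix_block_mat_mult sys_F_compose_block_vec block_vec_add block_vec_eq_iff
      const_matrix_0_mult)

section \<open>Velocity coefficients\<close>

theorem lemma2:
  fixes M C K :: "real ^ 'n ^ 'n"
    and f :: "(real, 'n + 'n) mps ^ 'n"
    and w w_dot :: "(complex, 'M::finite) mps ^ 'n"
    and R :: "(complex, 'M) mps ^ 'M"
    and m :: "nat ^ 'M"
  assumes "invertible M"
    and "vmps_nth (block_vec w w_dot) 0 = 0"
    and "vmps_nth R 0 = 0"
    and "invariance_equation M C K f (block_vec w w_dot) R"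
  shows "vmps_nth w_dot m = vmps_nth (vmps_jacobian w *v R) m"
proof (rule complex_of_real_matrix_mult_cancel[OF assms(1)])
  show "map_matrix complex_of_real M *v vmps_nth w_dot m =
      map_matrix complex_of_real M *v vmps_nth (vmps_jacobian w *v R) m"
    using invariance_equation_velocity_row[OF assms(4)]
    by (simp flip: vmps_nth_const_matrix_mult)
qed

end
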